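(* Let $m\ge 2$ and let $G=UT_m(\mathbb Z)$ be given with respect to its standard Mal'cev basis. Let $N$ be the dimension of Nickel's embedding of $G$ into $UT_N(\mathbb Z)$ with respect to this Mal'cev basis (the embedding computed by Nickel's algorithm). Then $N\ge 2^{\lfloor m/2\rfloor-1}$.
   Context: $UT_m(\mathbb Z)$ is the group of upper triangular $m\times m$ integer matrices with all diagonal entries equal to $1$. For $1\le i<j\le m$, $s_{i,j}=1+e_{i,j}$, where $e_{i,j}$ is the matrix with $(i,j)$ entry $1$ and all other entries $0$. A Mal'cev basis of a finitely generated torsion-free nilpotent group $G$ is a tuple $(a_1,\dots,a_n)$ of elements of $G$ such that every $g\in G$ can be written uniquely as $g=a_1^{x_1}\cdots a_n^{x_n}$ with $x_i\in\mathbb Z$, and such that $G=G_1>G_2>\cdots>G_n>1$ with $G_i=\langle a_i,\dots,a_n\rangle$ is a central series. The standard Mal'cev basis of $UT_m(\mathbb Z)$ is $(a_1,\dots,a_n)$, $n=m(m-1)/2$, with $a_k=s_{i,j}$ for $k=i+\sum_{\ell=1}^{j-i-1}(m-\ell)$; i.e. the $s_{i,j}$ are ordered by increasing $j-i$, and for equal $j-i$ by increasing $i$. Nickel's embedding with respect to a Mal'cev basis $(a_1,\dots,a_n)$: $G$ acts on $(\mathbb QG)^*$ (the space of $\mathbb{Q}$-linear maps $\mathbb QG\to\mathbb Q$, identified with functions $G\to\mathbb Q$) by $f^g(h)=f(hg^{-1})$. The coordinate functions are $t_i:G\to\mathbb Z$, $t_i(a_1^{x_1}\cdots a_n^{x_n})=x_i$.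 The $G$-submodule of $(\mathbb QG)^*$ generated by $t_1,\dots,t_n$ is a finite-dimensional faithful $G$-module, and Nickel's embedding is the resulting unitriangular matrix representation of $G$. Its dimension is the dimension over $\mathbb Q$ of this $G$-submodule. *)

theory Defs
  imports
    "Jordan_Normal_Form.Matrix"
    "HOL-Algebra.Generated_Groups"
    "HOL-Library.Function_Algebras"
begin

section \<open>Mal'cev bases\<close>

definition malcev_prod :: "('a, 'b) monoid_scheme \<Rightarrow> 'a list \<Rightarrow> int list \<Rightarrow> 'a" where
  "malcev_prod G as xs = foldr (\<lambda>(a, x) g. a [^]\<^bsub>G\<^esub> x \<otimes>\<^bsub>G\<^esub> g) (zip as xs) \<one>\<^bsub>G\<^esub>"

text \<open>
  With 0-based \<open>i\<close>, \<open>malcev_sub G as i\<close> is the subgroup generated by the elements of \<open>as\<close> from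
  position \<open>i\<close> on; for \<open>i = length as\<close> it is trivial.
\<close>

definition malcev_sub :: "('a, 'b) monoid_scheme \<Rightarrow> 'a list \<Rightarrow> nat \<Rightarrow> 'a set" where
  "malcev_sub G as i = generate G (set (drop i as))"

text \<open>
  The series is central iff \<open>[G, G\<^sub>i] \<subseteq> G\<^sub>i\<^sub>+\<^sub>1\<close> for all \<open>i\<close>; normality of each \<open>G\<^sub>i\<close> follows
  from this.
\<close>

definition malcev_basis :: "('a, 'b) monoid_scheme \<Rightarrow> 'a list \<Rightarrow> bool" where
  "malcev_basis G as \<longleftrightarrow>
     group G \<and> set as \<subseteq> carrier G \<and>
     (\<forall>g \<in> carrier G. \<exists>!xs. length xs = length as \<and> malcev_prod G as xs = g) \<and>
     malcev_sub G as 0 = carrier G \<and>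
     (\<forall>i < length as.
        malcev_sub G as (Suc i) \<subset> malcev_sub G as i \<and>
        (\<forall>g \<in> carrier G. \<forall>h \<in> malcev_sub G as i.
           g \<otimes>\<^bsub>G\<^esub> h \<otimes>\<^bsub>G\<^esub> inv\<^bsub>G\<^esub> g \<otimes>\<^bsub>G\<^esub> inv\<^bsub>G\<^esub> h \<in> malcev_sub G as (Suc i)))"


section \<open>Nickel's module\<close>

text \<open>
  The space \<open>(\<rat>G)\<^sup>*\<close> is the space of all functions from \<open>G\<close> to the rationals.  As the carrier of
  \<open>G\<close> need not be the whole type, these are represented by the functions that vanish outside the
  carrier.  The vector space structure is pointwise.
\<close>

global_interpretation rat_fun: vector_space "\<lambda>(c :: rat) (f :: 'a \<Rightarrow> rat) h. c * f h"
  by unfold_locales (auto simp: fun_eq_iff algebra_simps)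

definition dual_space :: "('a, 'b) monoid_scheme \<Rightarrow> ('a \<Rightarrow> rat) set" where
  "dual_space G = {f. \<forall>h. h \<notin> carrier G \<longrightarrow> f h = 0}"

definition dual_act :: "('a, 'b) monoid_scheme \<Rightarrow> 'a \<Rightarrow> ('a \<Rightarrow> rat) \<Rightarrow> 'a \<Rightarrow> rat" where
  "dual_act G g f = (\<lambda>h. if h \<in> carrier G then f (h \<otimes>\<^bsub>G\<^esub> inv\<^bsub>G\<^esub> g) else 0)"

definition dual_submodule :: "('a, 'b) monoid_scheme \<Rightarrow> ('a \<Rightarrow> rat) set \<Rightarrow> bool" where
  "dual_submodule G M \<longleftrightarrow>
     rat_fun.subspace M \<and> M \<subseteq> dual_space G \<and> (\<forall>g \<in> carrier G. \<forall>f \<in> M. dual_act G g f \<in> M)"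

text \<open>
  The \<open>i\<close>-th coordinate function (0-based), meaningful when \<open>as\<close> is a Mal'cev basis of \<open>G\<close>.
\<close>

definition malcev_coord :: "('a, 'b) monoid_scheme \<Rightarrow> 'a list \<Rightarrow> nat \<Rightarrow> 'a \<Rightarrow> rat" where
  "malcev_coord G as i g =
     (if g \<in> carrier G
      then of_int ((THE xs. length xs = length as \<and> malcev_prod G as xs = g) ! i)
      else 0)"

lemma malcev_coord_prod:
  assumes "malcev_basis G as" "malcev_prod G as xs \<in> carrier G" "length xs = length as"
  shows "malcev_coord G as i (malcev_prod G as xs) = of_int (xs ! i)"
proof -
  have "(THE ys. length ys = length as \<and> malcev_prod G as ys = malcev_prod G as xs) = xs"
    by (rule the1_equality) (use assms in \<open>auto simp: malcev_basis_def\<close>)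
  then show ?thesis using assms by (simp add: malcev_coord_def)
qed

definition nickel_module :: "('a, 'b) monoid_scheme \<Rightarrow> 'a list \<Rightarrow> ('a \<Rightarrow> rat) set" where
  "nickel_module G as = dual_submodule G hull {malcev_coord G as i | i. i < length as}"

lemma dual_submodule_nickel_module:
  assumes "group G"
  shows "dual_submodule G (nickel_module G as)"
proof -
  interpret group G by (rule assms)
  let ?T = "{malcev_coord G as i | i. i < length as}"
  have dual: "dual_submodule G (dual_space G)"
    by (auto simp: dual_submodule_def dual_space_def dual_act_def rat_fun.subspace_def)
  have T: "?T \<subseteq> dual_space G"
    by (auto simp: dual_space_def malcev_coord_def)
  have "nickel_module G as \<subseteq> dual_space G"
    unfolding nickel_module_def using T dual by (rule hull_minimal)
  then show ?thesis
    unfolding dual_submodule_def nickel_module_def hull_def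
    by (auto simp: rat_fun.subspace_def)
qed

text \<open>
  The dimension of Nickel's embedding.  The library's \<open>dim\<close> is 0 on infinite-dimensional spaces,
  so a positive lower bound on it includes the assertion that the module is finite-dimensional.
\<close>

definition nickel_dim :: "('a, 'b) monoid_scheme \<Rightarrow> 'a list \<Rightarrow> nat" where
  "nickel_dim G as = rat_fun.dim (nickel_module G as)"


section \<open>The unitriangular groups and their standard Mal'cev bases\<close>

definition UT :: "nat \<Rightarrow> int mat monoid" where
  "UT m = \<lparr>carrier = {A \<in> carrier_mat m m. upper_triangular A \<and> (\<forall>i<m. A $$ (i, i) = 1)},
           mult = (*), one = 1\<^sub>m m\<rparr>"

text \<open>
  Rows and columns are indexed from 0 as usual for \<open>mat\<close>, so the elementary matrix
  \<open>s\<^sub>i\<^sub>,\<^sub>j\<close> of the 1-based convention is \<open>elem_mat m (i - 1) (j - 1)\<close>.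
\<close>

definition elem_mat :: "nat \<Rightarrow> nat \<Rightarrow> nat \<Rightarrow> int mat" where
  "elem_mat m i j = 1\<^sub>m m + mat m m (\<lambda>p. if p = (i, j) then 1 else 0)"

definition std_positions :: "nat \<Rightarrow> (nat \<times> nat) list" where
  "std_positions m = concat (map (\<lambda>d. map (\<lambda>i. (i, i + d)) [0..<m - d]) [1..<m])"

definition std_malcev_basis :: "nat \<Rightarrow> int mat list" where
  "std_malcev_basis m = map (\<lambda>(i, j). elem_mat m i j) (std_positions m)"

lemma std_positions_set: "set (std_positions m) = {(i, j). i < j \<and> j < m}"
proof -
  have "\<exists>d\<in>{1..<m}. (i, j) \<in> (\<lambda>i. (i, i + d)) ` {0..<m - d}" if "i < j" "j < m" for i j
    using that by (intro bexI[of _ "j - i"]) auto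
  then show ?thesis by (auto simp: std_positions_def)
qed

lemma concat_nth:
  assumes "d < n" "i < length (f d)"
  shows "concat (map f [0..<n]) ! ((\<Sum>l<d. length (f l)) + i) = f d ! i"
proof -
  have "[0..<n] = [0..<d] @ d # [Suc d..<n]"
    using assms(1) by (metis le_add_same_cancel1 less_imp_add_positive upt_add_eq_append upt_conv_Cons zero_le order.strict_implies_order)
  moreover have "length (concat (map f [0..<d])) = (\<Sum>l<d. length (f l))"
    by (simp add: length_concat o_def interv_sum_list_conv_sum_set_nat atLeast0LessThan)
  ultimately show ?thesis using assms(2) by (simp add: nth_append)
qed

text \<open>
  The position formula \<open>k = i + (\<Sum>l = 1..j - i - 1. m - l)\<close> for \<open>s\<^sub>i\<^sub>,\<^sub>j\<close>;
  it has the same form for 0-based \<open>k\<close> and \<open>i, j\<close>.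
\<close>

lemma std_positions_nth:
  assumes "i < j" "j < m"
  shows "std_positions m ! (i + (\<Sum>l = 1..j - i - 1. m - l)) = (i, j)"
proof -
  let ?f = "\<lambda>d. map (\<lambda>i. (i, i + Suc d)) [0..<m - Suc d]"
  have eq: "std_positions m = concat (map ?f [0..<m - 1])"
  proof -
    have "[1..<m] = map Suc [0..<m - 1]" using assms by (simp add: map_Suc_upt)
    then show ?thesis by (simp add: std_positions_def o_def)
  qed
  have "(\<Sum>l = 1..j - i - 1. m - l) = (\<Sum>l<j - i - 1. length (?f l))"
    by (rule sum.reindex_bij_witness[of _ Suc "\<lambda>l. l - 1"]) auto
  then show ?thesis
    using concat_nth[of "j - i - 1" "m - 1" i ?f] assms unfolding eq
    by (simp add: add.commute)
qed


section \<open>The standard basis is a Mal'cev basis\<close>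

text \<open>
  The auxiliary \<open>zero_on m us\<close> consists of the matrices vanishing at the positions \<open>us\<close>; for
  the prefixes \<open>us\<close> of \<open>std_positions m\<close> these are the terms of the central series.  The matrix
  \<open>trans_mat m (i, j) x\<close> is the power \<open>s\<^sub>i\<^sub>,\<^sub>j\<^sup>x\<close>.
\<close>

lemma std_positions_prefix:
  assumes "std_positions m = us @ (i, j) # vs"
  shows "(i, j) \<notin> set us" "i < l \<Longrightarrow> l < j \<Longrightarrow> (i, l) \<in> set us" "i < l \<Longrightarrow> l < j \<Longrightarrow> (l, j) \<in> set us"
proof -
  let ?lt = "\<lambda>(i, j) (i', j'). j - i < j' - i' \<or> j - i = j' - i' \<and> i < (i' :: nat)"
  have "sorted_wrt ?lt (concat (map (\<lambda>d. map (\<lambda>i. (i, i + d)) [0..<m - d]) [Suc 0..<n]))" for n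
    by (induction n) (auto simp: sorted_wrt_append sorted_wrt_map)
  then have s: "sorted_wrt ?lt (std_positions m)" by (simp add: std_positions_def)
  then show "(i, j) \<notin> set us" unfolding assms by (auto simp: sorted_wrt_append)
  have ij: "i < j" "j < m" using std_positions_set[of m] assms by auto
  have "p \<in> set us" if "p \<in> set (std_positions m)" "?lt p (i, j)" for p
    using that s unfolding assms by (auto simp: sorted_wrt_append)
  then show "i < l \<Longrightarrow> l < j \<Longrightarrow> (i, l) \<in> set us" "i < l \<Longrightarrow> l < j \<Longrightarrow> (l, j) \<in> set us"
    using ij by (auto simp: std_positions_set)
qed

definition zero_on :: "nat \<Rightarrow> (nat \<times> nat) list \<Rightarrow> int mat set" where
  "zero_on m us = {A \<in> carrier (UT m). \<forall>p \<in> set us. A $$ p = 0}"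

definition trans_mat :: "nat \<Rightarrow> nat \<times> nat \<Rightarrow> int \<Rightarrow> int mat" where
  "trans_mat m p x = mat m m (\<lambda>q. if q = p then x else if fst q = snd q then 1 else 0)"

lemma UT_simps [simp]: "A \<otimes>\<^bsub>UT m\<^esub> B = A * B" "\<one>\<^bsub>UT m\<^esub> = 1\<^sub>m m"
  by (simp_all add: UT_def)

lemma UT_iff: "A \<in> carrier (UT m) \<longleftrightarrow> A \<in> carrier_mat m m \<and>
    (\<forall>i<m. \<forall>j<i. A $$ (i, j) = 0) \<and> (\<forall>i<m. A $$ (i, i) = 1)"
  by (auto simp: UT_def upper_triangular_def)

lemma mult_entry:
  assumes "A \<in> carrier (UT m)" "B \<in> carrier (UT m)" "i < j" "j < m"
  shows "(A * B) $$ (i, j) = A $$ (i, j) + B $$ (i, j) + (\<Sum>l\<in>{i<..<j}. A $$ (i, l) * B $$ (l, j))"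
proof -
  have "(A * B) $$ (i, j) = (\<Sum>l\<in>{0..<m}. A $$ (i, l) * B $$ (l, j))"
    using assms by (auto simp: UT_iff scalar_prod_def)
  also have "\<dots> = (\<Sum>l\<in>{i..j}. A $$ (i, l) * B $$ (l, j))"
    using assms by (intro sum.mono_neutral_right) (auto simp: UT_iff not_le)
  also have "{i..j} = insert i (insert j {i<..<j})" using assms by auto
  finally show ?thesis using assms by (simp add: UT_iff)
qed

lemma UT_closed:
  assumes A: "A \<in> carrier (UT m)" and B: "B \<in> carrier (UT m)"
  shows "A * B \<in> carrier (UT m)"
proof -
  have "(A * B) $$ (i, j) = (if i = j then 1 else 0)" if "i < m" "j \<le> i" for i j
  proof -
    have "(A * B) $$ (i, j) = (\<Sum>l\<in>{0..<m}. A $$ (i, l) * B $$ (l, j))"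
      using A B that by (auto simp: UT_iff scalar_prod_def)
    also have "\<dots> = (\<Sum>l\<in>{0..<m}. if l = i then (if i = j then 1 else 0) else 0)"
    proof (rule sum.cong[OF refl])
      fix l assume "l \<in> {0..<m}"
      then show "A $$ (i, l) * B $$ (l, j) = (if l = i then (if i = j then 1 else 0) else 0)"
        using A B that by (cases "l < i"; cases "l = i"; cases "i = j") (auto simp: UT_iff)
    qed
    finally show ?thesis using that by simp
  qed
  then show ?thesis using A B by (auto simp: UT_iff)
qed

lemma one_UT: "1\<^sub>m m \<in> carrier (UT m)" by (auto simp: UT_iff)

lemma trans_mat_UT: "i < j \<Longrightarrow> trans_mat m (i, j) x \<in> carrier (UT m)"
  by (auto simp: UT_iff trans_mat_def)

lemma trans_mat_0: "i < j \<Longrightarrow> trans_mat m (i, j) 0 = 1\<^sub>m m"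
  by (rule eq_matI) (auto simp: trans_mat_def)

lemma elem_mat_trans: "i < j \<Longrightarrow> elem_mat m i j = trans_mat m (i, j) 1"
  by (rule eq_matI) (auto simp: trans_mat_def elem_mat_def)

lemma UT_eqI:
  assumes "A \<in> carrier (UT m)" "B \<in> carrier (UT m)" "\<And>i j. i < j \<Longrightarrow> j < m \<Longrightarrow> A $$ (i, j) = B $$ (i, j)"
  shows "A = B"
proof (rule eq_matI)
  fix i j assume "i < dim_row B" "j < dim_col B"
  then show "A $$ (i, j) = B $$ (i, j)"
    using assms by (cases i j rule: linorder_cases) (auto simp: UT_iff)
qed (use assms in \<open>auto simp: UT_iff\<close>)

lemma trans_mat_entry: "i < m \<Longrightarrow> j < m \<Longrightarrow> i < j \<Longrightarrow> trans_mat m p x $$ (i, j) = (if (i, j) = p then x else 0)"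
  by (auto simp: trans_mat_def)

lemma trans_mat_add:
  assumes "i < j" "j < m"
  shows "trans_mat m (i, j) x * trans_mat m (i, j) y = trans_mat m (i, j) (x + y)"
proof (rule UT_eqI[of _ m])
  fix k l assume kl: "k < l" "l < m"
  have "(\<Sum>n\<in>{k<..<l}. trans_mat m (i, j) x $$ (k, n) * trans_mat m (i, j) y $$ (n, l)) = 0"
    by (rule sum.neutral) (use kl in \<open>auto simp: trans_mat_entry\<close>)
  then show "(trans_mat m (i, j) x * trans_mat m (i, j) y) $$ (k, l) = trans_mat m (i, j) (x + y) $$ (k, l)"
    using kl assms by (subst mult_entry) (auto simp: trans_mat_UT trans_mat_entry)
qed (use assms in \<open>auto intro: UT_closed trans_mat_UT\<close>)

lemma zero_on_mult_entry:
  assumes ps: "std_positions m = us @ p # vs"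
    and A: "A \<in> carrier (UT m)" and B: "B \<in> carrier (UT m)"
    and z: "A \<in> zero_on m us \<or> B \<in> zero_on m us"
  shows "(A * B) $$ p = A $$ p + B $$ p"
proof -
  obtain i j where p: "p = (i, j)" by (cases p)
  have ij: "i < j" "j < m" using std_positions_set[of m] ps p by auto
  have "(\<Sum>l\<in>{i<..<j}. A $$ (i, l) * B $$ (l, j)) = 0"
    by (rule sum.neutral)
      (use z std_positions_prefix(2,3)[OF ps[unfolded p]] in \<open>auto simp: zero_on_def\<close>)
  then show ?thesis using A B ij by (simp add: p mult_entry)
qed

lemma zero_on_mono: "set us \<subseteq> set vs \<Longrightarrow> zero_on m vs \<subseteq> zero_on m us"
  by (auto simp: zero_on_def)

lemma zero_on_snoc: "A \<in> zero_on m (us @ [p]) \<longleftrightarrow> A \<in> zero_on m us \<and> A $$ p = 0"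
  by (auto simp: zero_on_def)

lemma zero_on_mult:
  assumes "std_positions m = us @ vs" "A \<in> zero_on m us" "B \<in> zero_on m us"
  shows "A * B \<in> zero_on m us"
  using assms
proof (induction us arbitrary: vs rule: rev_induct)
  case Nil
  then show ?case by (simp add: zero_on_def UT_closed)
next
  case (snoc p us)
  then show ?case using zero_on_mult_entry[of m us p vs A B]
    by (auto simp: zero_on_snoc) (auto simp: zero_on_def)
qed

lemma trans_mat_zero_on:
  assumes "std_positions m = us @ p # vs"
  shows "trans_mat m p x \<in> zero_on m us" "trans_mat m p x $$ p = x"
proof -
  obtain i j where p: "p = (i, j)" by (cases p)
  have "i < j" "j < m" "set us \<subseteq> {(i, j). i < j \<and> j < m}"
    using std_positions_set[of m] assms p by auto
  then show "trans_mat m p x \<in> zero_on m us" "trans_mat m p x $$ p = x"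
    using std_positions_prefix(1)[OF assms[unfolded p]]
    by (auto simp: zero_on_def p trans_mat_UT trans_mat_entry)
qed

lemma trans_mat_cancel:
  assumes "std_positions m = us @ p # vs" "A \<in> carrier (UT m)" "x + y = 0"
  shows "trans_mat m p x * (trans_mat m p y * A) = A"
proof -
  obtain i j where p: "p = (i, j)" by (cases p)
  have ij: "i < j" "j < m" using std_positions_set[of m] assms(1) p by auto
  have "trans_mat m p x * (trans_mat m p y * A) = (trans_mat m p x * trans_mat m p y) * A"
    using assms(2) by (auto simp: UT_iff trans_mat_def intro!: assoc_mult_mat[symmetric])
  also have "\<dots> = A" using ij assms(2,3) left_mult_one_mat[of A m m] by (auto simp: p trans_mat_add trans_mat_0 UT_iff)
  finally show ?thesis .
qed

lemma zero_on_all: "zero_on m (std_positions m) = {1\<^sub>m m}"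
proof -
  have "A = 1\<^sub>m m" if "A \<in> zero_on m (std_positions m)" for A
    using that by (intro UT_eqI[of _ m]) (auto simp: zero_on_def one_UT std_positions_set)
  then show ?thesis by (auto simp: zero_on_def one_UT std_positions_set)
qed

definition trans_prod :: "nat \<Rightarrow> (nat \<times> nat) list \<Rightarrow> int list \<Rightarrow> int mat" where
  "trans_prod m ps xs = foldr (\<lambda>(p, x) A. trans_mat m p x * A) (zip ps xs) (1\<^sub>m m)"

lemma trans_prod_Cons [simp]: "trans_prod m (p # ps) (x # xs) = trans_mat m p x * trans_prod m ps xs"
  and trans_prod_Nil [simp]: "trans_prod m [] xs = 1\<^sub>m m"
  by (simp_all add: trans_prod_def)

lemma zero_on_step:
  assumes ps: "std_positions m = us @ p # vs" and A: "A \<in> zero_on m us"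
  shows "trans_mat m p (- (A $$ p)) * A \<in> zero_on m (us @ [p])"
proof -
  let ?T = "trans_mat m p (- (A $$ p))"
  have "?T \<in> zero_on m us" "?T $$ p = - (A $$ p)" using trans_mat_zero_on[OF ps] by auto
  then show ?thesis using zero_on_mult[OF ps _ A] zero_on_mult_entry[OF ps, of ?T A] A
    by (auto simp: zero_on_snoc) (auto simp: zero_on_def)
qed

lemma trans_prod_zero_on:
  "std_positions m = us @ vs \<Longrightarrow> length xs = length vs \<Longrightarrow> trans_prod m vs xs \<in> zero_on m us"
proof (induction vs arbitrary: us xs)
  case Nil
  then show ?case using zero_on_all[of m] by simp
next
  case (Cons p vs)
  then obtain x ys where xs: "xs = x # ys" by (cases xs) auto
  have "trans_prod m vs ys \<in> zero_on m (us @ [p])" using Cons.IH[of "us @ [p]" ys] Cons.prems xs by simp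
  then show ?case using zero_on_mult[OF Cons.prems(1) trans_mat_zero_on(1)[OF Cons.prems(1)]]
    by (simp add: xs zero_on_snoc)
qed

lemma trans_prod_exists:
  "std_positions m = us @ vs \<Longrightarrow> A \<in> zero_on m us \<Longrightarrow> \<exists>xs. length xs = length vs \<and> trans_prod m vs xs = A"
proof (induction vs arbitrary: us A)
  case Nil
  then show ?case by (auto simp: zero_on_all)
next
  case (Cons p vs)
  obtain xs where "length xs = length vs" "trans_prod m vs xs = trans_mat m p (- (A $$ p)) * A"
    using Cons.IH[OF _ zero_on_step[OF Cons.prems]] Cons.prems by auto
  then show ?case using trans_mat_cancel[OF Cons.prems(1)] Cons.prems(2)
    by (intro exI[of _ "A $$ p # xs"]) (auto simp: zero_on_def)
qed

lemma trans_prod_unique: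
  "std_positions m = us @ vs \<Longrightarrow> length xs = length vs \<Longrightarrow> length ys = length vs \<Longrightarrow>
    trans_prod m vs xs = trans_prod m vs ys \<Longrightarrow> xs = ys"
proof (induction vs arbitrary: us xs ys)
  case (Cons p vs)
  obtain x xs' where xs: "xs = x # xs'" "length xs' = length vs" using Cons.prems by (cases xs) auto
  obtain y ys' where ys: "ys = y # ys'" "length ys' = length vs" using Cons.prems by (cases ys) auto
  have ps: "std_positions m = (us @ [p]) @ vs" using Cons.prems by simp
  have z: "trans_prod m vs zs \<in> carrier (UT m)" "(trans_mat m p z * trans_prod m vs zs) $$ p = z"
    if "length zs = length vs" for z zs
    using trans_prod_zero_on[OF ps that] trans_mat_zero_on[OF Cons.prems(1), of z]
      zero_on_mult_entry[OF Cons.prems(1), of "trans_mat m p z" "trans_prod m vs zs"]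
    by (auto simp: zero_on_snoc) (auto simp: zero_on_def)
  have xy: "x = y" using z(2)[OF xs(2), of x] z(2)[OF ys(2), of y] Cons.prems(4) xs(1) ys(1) by simp
  have "trans_mat m p x * trans_prod m vs xs' = trans_mat m p x * trans_prod m vs ys'"
    using Cons.prems(4) by (simp only: xs(1) ys(1) xy trans_prod_Cons)
  then have "trans_prod m vs xs' = trans_prod m vs ys'"
    using trans_mat_cancel[OF Cons.prems(1) z(1)[OF xs(2)], of "-x" x]
      trans_mat_cancel[OF Cons.prems(1) z(1)[OF ys(2)], of "-x" x] by (metis add.left_inverse)
  then show ?case using Cons.IH[OF ps xs(2) ys(2)] xs ys xy by simp
qed auto

lemma zero_on_left_inverse:
  "std_positions m = us @ vs \<Longrightarrow> A \<in> zero_on m us \<Longrightarrow> \<exists>B \<in> zero_on m us. B * A = 1\<^sub>m m"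
proof (induction vs arbitrary: us A)
  case Nil
  then show ?case by (auto simp: zero_on_all)
next
  case (Cons p vs)
  let ?T = "trans_mat m p (- (A $$ p))"
  obtain B where B: "B \<in> zero_on m (us @ [p])" "B * (?T * A) = 1\<^sub>m m"
    using Cons.IH[OF _ zero_on_step[OF Cons.prems]] Cons.prems by auto
  have "B * ?T \<in> zero_on m us"
    using zero_on_mult[OF Cons.prems(1) _ trans_mat_zero_on(1)[OF Cons.prems(1)]] B(1)
    by (simp add: zero_on_snoc)
  moreover have "(B * ?T) * A = B * (?T * A)"
    using B(1) Cons.prems(2) by (auto simp: zero_on_def UT_iff trans_mat_def intro!: assoc_mult_mat)
  ultimately show ?case using B(2) by metis
qed

lemma zero_on_Nil: "zero_on m [] = carrier (UT m)" by (simp add: zero_on_def)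

lemma group_UT: "group (UT m)"
proof (rule groupI)
  fix A assume "A \<in> carrier (UT m)"
  then show "\<exists>B\<in>carrier (UT m). B \<otimes>\<^bsub>UT m\<^esub> A = \<one>\<^bsub>UT m\<^esub>"
    using zero_on_left_inverse[of m "[]" "std_positions m" A] by (auto simp: zero_on_Nil)
next
  fix A B C assume "A \<in> carrier (UT m)" "B \<in> carrier (UT m)" "C \<in> carrier (UT m)"
  then show "A \<otimes>\<^bsub>UT m\<^esub> B \<otimes>\<^bsub>UT m\<^esub> C = A \<otimes>\<^bsub>UT m\<^esub> (B \<otimes>\<^bsub>UT m\<^esub> C)"
    using assoc_mult_mat[of A m m B m C m] by (auto simp: UT_iff)
next
  fix A assume "A \<in> carrier (UT m)"
  then show "\<one>\<^bsub>UT m\<^esub> \<otimes>\<^bsub>UT m\<^esub> A = A" using left_mult_one_mat[of A m m] by (auto simp: UT_iff)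
qed (auto simp: UT_closed one_UT)

lemma elem_mat_pow:
  assumes "i < j" "j < m"
  shows "elem_mat m i j [^]\<^bsub>UT m\<^esub> (x :: int) = trans_mat m (i, j) x"
proof -
  interpret group "UT m" by (rule group_UT)
  have n: "elem_mat m i j [^]\<^bsub>UT m\<^esub> (n :: nat) = trans_mat m (i, j) (int n)" for n
    by (induction n) (use assms in \<open>auto simp: trans_mat_0 elem_mat_trans trans_mat_add add.commute\<close>)
  have inv: "inv\<^bsub>UT m\<^esub> trans_mat m (i, j) y = trans_mat m (i, j) (- y)" for y
    by (rule inv_equality) (use assms in \<open>auto simp: trans_mat_add trans_mat_0 trans_mat_UT\<close>)
  show ?thesis
    by (cases "x < 0") (auto simp: int_pow_def2 n inv)
qed

lemma malcev_prod_eq: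
  assumes "set ps \<subseteq> set (std_positions m)"
  shows "malcev_prod (UT m) (map (\<lambda>(i, j). elem_mat m i j) ps) xs = trans_prod m ps xs"
  using assms
proof (induction ps arbitrary: xs)
  case (Cons p ps)
  then show ?case
    by (cases xs) (auto simp: malcev_prod_def trans_prod_def elem_mat_pow std_positions_set)
qed (simp add: malcev_prod_def)

lemma subgroup_zero_on:
  assumes "std_positions m = us @ vs"
  shows "subgroup (zero_on m us) (UT m)"
proof -
  interpret group "UT m" by (rule group_UT)
  show ?thesis
  proof (rule subgroupI)
    show "zero_on m us \<noteq> {}"
      using trans_prod_zero_on[OF assms, of "replicate (length vs) 0"] by auto
    fix A assume A: "A \<in> zero_on m us"
    then obtain B where B: "B \<in> zero_on m us" "B * A = 1\<^sub>m m" using zero_on_left_inverse[OF assms] by auto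
    then have "inv\<^bsub>UT m\<^esub> A = B" using A by (intro inv_equality) (auto simp: zero_on_def)
    then show "inv\<^bsub>UT m\<^esub> A \<in> zero_on m us" using B by simp
  qed (use zero_on_mult[OF assms] in \<open>auto simp: zero_on_def\<close>)
qed

lemma malcev_sub_eq:
  assumes ps: "std_positions m = us @ vs"
  shows "malcev_sub (UT m) (std_malcev_basis m) (length us) = zero_on m us"
proof -
  interpret group "UT m" by (rule group_UT)
  let ?S = "set (map (\<lambda>(i, j). elem_mat m i j) vs)"
  have sub: "?S \<subseteq> zero_on m us"
  proof
    fix A assume "A \<in> ?S"
    then obtain i j where ij: "(i, j) \<in> set vs" "A = elem_mat m i j" by auto
    then obtain ws zs where w: "vs = ws @ (i, j) # zs" by (meson split_list)
    have "i < j" using ij ps std_positions_set[of m] by auto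
    then show "A \<in> zero_on m us"
      using trans_mat_zero_on(1)[of m "us @ ws" "(i, j)" zs 1] zero_on_mono[of us "us @ ws" m] ps w ij
      by (auto simp: elem_mat_trans)
  qed
  have "generate (UT m) ?S \<subseteq> zero_on m us"
    using sub subgroup_zero_on[OF ps] by (simp add: generate_subgroup_incl)
  moreover have "zero_on m us \<subseteq> generate (UT m) ?S"
  proof
    fix A assume "A \<in> zero_on m us"
    then obtain xs where xs: "length xs = length vs" "trans_prod m vs xs = A"
      using trans_prod_exists[OF ps] by blast
    have S: "?S \<subseteq> carrier (UT m)" using sub by (auto simp: zero_on_def)
    have "trans_prod m ws ys \<in> generate (UT m) ?S" if "set ws \<subseteq> set vs" for ws ys
      using that
    proof (induction ws arbitrary: ys)
      case Nil
      then show ?case using generate.one[of "UT m" ?S] by simp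
    next
      case (Cons p ws)
      obtain i j where p: "p = (i, j)" by (cases p)
      show ?case
      proof (cases ys)
        case Nil
        then show ?thesis using generate.one[of "UT m" ?S] by (simp add: trans_prod_def)
      next
        case (Cons y zs)
        have ij: "i < j" "j < m" using Cons.prems p ps std_positions_set[of m] by auto
        have "elem_mat m i j \<in> generate (UT m) ?S"
          using Cons.prems p by (intro generate.incl) auto
        then have "elem_mat m i j [^]\<^bsub>UT m\<^esub> y \<in> generate (UT m) ?S"
          using subgroup_int_pow_closed[OF generate_is_subgroup[OF S]] by blast
        moreover have "trans_prod m ws zs \<in> generate (UT m) ?S" using Cons.IH Cons.prems by simp
        ultimately show ?thesis
          using generate.eng[of _ "UT m" ?S] by (simp add: \<open>ys = y # zs\<close> p elem_mat_pow ij)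
      qed
    qed
    then show "A \<in> generate (UT m) ?S" using xs by blast
  qed
  ultimately show ?thesis by (simp add: malcev_sub_def std_malcev_basis_def ps)
qed

lemma zero_on_commutator:
  assumes ps: "std_positions m = us @ p # vs"
    and A: "A \<in> carrier (UT m)" and B: "B \<in> zero_on m us"
  shows "A \<otimes>\<^bsub>UT m\<^esub> B \<otimes>\<^bsub>UT m\<^esub> inv\<^bsub>UT m\<^esub> A \<otimes>\<^bsub>UT m\<^esub> inv\<^bsub>UT m\<^esub> B \<in> zero_on m (us @ [p])"
proof -
  interpret group "UT m" by (rule group_UT)
  have B': "B \<in> carrier (UT m)" using B by (simp add: zero_on_def)
  define C where "C = A \<otimes>\<^bsub>UT m\<^esub> B \<otimes>\<^bsub>UT m\<^esub> inv\<^bsub>UT m\<^esub> A \<otimes>\<^bsub>UT m\<^esub> inv\<^bsub>UT m\<^esub> B"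
  have C: "C \<in> carrier (UT m)" using A B' unfolding C_def by (intro m_closed inv_closed)
  have "C \<otimes>\<^bsub>UT m\<^esub> (B \<otimes>\<^bsub>UT m\<^esub> A) = A \<otimes>\<^bsub>UT m\<^esub> B"
  proof -
    have "C \<otimes>\<^bsub>UT m\<^esub> (B \<otimes>\<^bsub>UT m\<^esub> A) = A \<otimes>\<^bsub>UT m\<^esub> B \<otimes>\<^bsub>UT m\<^esub> inv\<^bsub>UT m\<^esub> A \<otimes>\<^bsub>UT m\<^esub> (inv\<^bsub>UT m\<^esub> B \<otimes>\<^bsub>UT m\<^esub> B) \<otimes>\<^bsub>UT m\<^esub> A"
      using A B' unfolding C_def by (simp only: m_assoc m_closed inv_closed)
    also have "\<dots> = A \<otimes>\<^bsub>UT m\<^esub> B \<otimes>\<^bsub>UT m\<^esub> (inv\<^bsub>UT m\<^esub> A \<otimes>\<^bsub>UT m\<^esub> A)"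
      using A B' by (simp only: m_assoc m_closed inv_closed l_inv r_one)
    also have "\<dots> = A \<otimes>\<^bsub>UT m\<^esub> B" using A B' by (simp only: m_closed l_inv r_one)
    finally show ?thesis .
  qed
  then have CBA: "C * (B * A) = A * B" by simp
  have BA: "B * A \<in> carrier (UT m)" using A B' by (rule UT_closed[rotated])
  have "C \<in> zero_on m ws" if "us @ [p] = ws @ zs" for ws zs
    using that
  proof (induction ws arbitrary: zs rule: rev_induct)
    case Nil
    then show ?case using C by (simp add: zero_on_Nil)
  next
    case (snoc q ws)
    have ps': "std_positions m = ws @ q # (zs @ vs)" using ps snoc.prems by simp
    have "set ws \<subseteq> set us" using snoc.prems by (cases zs rule: rev_cases) auto
    then have Bz: "B \<in> zero_on m ws" using B zero_on_mono by blast
    have Cz: "C \<in> zero_on m ws" using snoc.IH snoc.prems by simp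
    have "C $$ q + (B * A) $$ q = (A * B) $$ q"
      using zero_on_mult_entry[OF ps' C BA] Cz CBA by simp
    moreover have "(A * B) $$ q = (B * A) $$ q"
      using zero_on_mult_entry[OF ps' A B'] zero_on_mult_entry[OF ps' B' A] Bz by simp
    ultimately show ?case using Cz by (simp add: zero_on_snoc)
  qed
  from this[of "us @ [p]" "[]"] show ?thesis by (simp add: C_def)
qed

theorem malcev_basis_UT: "malcev_basis (UT m) (std_malcev_basis m)"
  unfolding malcev_basis_def
proof (intro conjI ballI allI impI)
  let ?ps = "std_positions m"
  have len: "length (std_malcev_basis m) = length ?ps" by (simp add: std_malcev_basis_def)
  show "group (UT m)" by (rule group_UT)
  show "set (std_malcev_basis m) \<subseteq> carrier (UT m)"
    by (auto simp: std_malcev_basis_def std_positions_set elem_mat_trans trans_mat_UT)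
  show "malcev_sub (UT m) (std_malcev_basis m) 0 = carrier (UT m)"
    using malcev_sub_eq[of m "[]"] by (simp add: zero_on_Nil)
  show "\<exists>!xs. length xs = length (std_malcev_basis m) \<and> malcev_prod (UT m) (std_malcev_basis m) xs = g"
    if g: "g \<in> carrier (UT m)" for g
  proof (rule ex_ex1I)
    show "\<exists>xs. length xs = length (std_malcev_basis m) \<and> malcev_prod (UT m) (std_malcev_basis m) xs = g"
      using trans_prod_exists[of m "[]" ?ps g] g
      unfolding std_malcev_basis_def by (simp add: zero_on_Nil malcev_prod_eq)
  next
    fix xs ys
    assume "length xs = length (std_malcev_basis m) \<and> malcev_prod (UT m) (std_malcev_basis m) xs = g"
      and "length ys = length (std_malcev_basis m) \<and> malcev_prod (UT m) (std_malcev_basis m) ys = g"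
    then show "xs = ys"
      using trans_prod_unique[of m "[]" ?ps xs ys]
      unfolding std_malcev_basis_def by (simp add: malcev_prod_eq)
  qed
  fix k assume k: "k < length (std_malcev_basis m)"
  have ps: "?ps = take k ?ps @ ?ps ! k # drop (Suc k) ?ps" using k len by (simp add: id_take_nth_drop)
  have tk: "take (Suc k) ?ps = take k ?ps @ [?ps ! k]" using k len by (simp add: take_Suc_conv_app_nth)
  have G1: "malcev_sub (UT m) (std_malcev_basis m) k = zero_on m (take k ?ps)"
    using malcev_sub_eq[OF ps] k len by simp
  have G2: "malcev_sub (UT m) (std_malcev_basis m) (Suc k) = zero_on m (take k ?ps @ [?ps ! k])"
    using malcev_sub_eq[of m "take k ?ps @ [?ps ! k]" "drop (Suc k) ?ps"] k len
    by (simp add: ps[symmetric])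
  show "malcev_sub (UT m) (std_malcev_basis m) (Suc k) \<subset> malcev_sub (UT m) (std_malcev_basis m) k"
    unfolding G1 G2
  proof (rule psubsetI)
    show "zero_on m (take k ?ps @ [?ps ! k]) \<subseteq> zero_on m (take k ?ps)" by (rule zero_on_mono) auto
    show "zero_on m (take k ?ps @ [?ps ! k]) \<noteq> zero_on m (take k ?ps)"
      using trans_mat_zero_on[OF ps, of 1] zero_on_snoc[of _ m "take k ?ps" "?ps ! k"] by force
  qed
  show "g \<otimes>\<^bsub>UT m\<^esub> h \<otimes>\<^bsub>UT m\<^esub> inv\<^bsub>UT m\<^esub> g \<otimes>\<^bsub>UT m\<^esub> inv\<^bsub>UT m\<^esub> h
      \<in> malcev_sub (UT m) (std_malcev_basis m) (Suc k)"
    if "g \<in> carrier (UT m)" "h \<in> malcev_sub (UT m) (std_malcev_basis m) k" for g h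
    using zero_on_commutator[OF ps] that unfolding G1 G2 by blast
qed

end

theory Submission
  imports Defs
begin

text \<open>
  Let \<open>n = m - 1\<close> and index from 0.  If \<open>B\<close> is the inverse of \<open>g\<close>, the coordinates of \<open>g\<close> are
  read off by processing the positions \<open>p = (i, j)\<close> in order: the coordinate at \<open>p\<close> is \<open>- B $$ p\<close>,
  and then \<open>B $$ p\<close> times column \<open>i\<close> is subtracted from column \<open>j\<close>.  So coordinates are
  polynomials in the entries of \<open>B\<close>, and the module is finite-dimensional.

  For the lower bound, translates of the last coordinate \<open>t\<close> are evaluated where
  \<open>B = (1 - b) (1 - a)\<close>, with \<open>a\<close> and \<open>b\<close> sums of elementary matrices at \<open>(i, i + 1)\<close> for \<open>i\<close> in
  \<open>Q\<close> and \<open>P\<close>; the translating element determines \<open>P\<close>, the point of evaluation \<open>Q\<close>.  If some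
  \<open>i < n\<close> is in neither set then \<open>B\<close> is block diagonal and \<open>t = 0\<close>.  If \<open>P\<close> and \<open>Q\<close> partition
  \<open>{..<n}\<close>, then once the superdiagonal is processed row \<open>r\<close> of \<open>B\<close> is trivial unless \<open>r \<in> P\<close>,
  and the corner entry is 1 when \<open>0 \<in> P\<close> and \<open>1 \<in> Q\<close>.  A position \<open>(i, n)\<close> changes the corner by
  \<open>B $$ (0, i) * B $$ (i, n)\<close>, where the first factor has already been cleared if \<open>2 * i \<le> n\<close>, and
  the second vanishes if \<open>i \<notin> P\<close>.  So the corner stays 1 as soon as \<open>P\<close> contains no \<open>i\<close> with
  \<open>n < 2 * i\<close> and \<open>i \<le> n - 2\<close>.  This leaves \<open>n div 2\<close> indices that may be put freely into \<open>P\<close>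
  or \<open>Q\<close>, hence a matrix of values that is triangular with respect to inclusion.
\<close>

section \<open>Locally finite functions\<close>

lemma triangular_independent:
  fixes f :: "'i \<Rightarrow> 'a \<Rightarrow> rat" and \<rho> :: "'i \<Rightarrow> nat"
  assumes fin: "finite I"
    and diag: "\<And>i. i \<in> I \<Longrightarrow> f i (x i) \<noteq> 0"
    and tri: "\<And>i j. i \<in> I \<Longrightarrow> j \<in> I \<Longrightarrow> f j (x i) \<noteq> 0 \<Longrightarrow> i = j \<or> \<rho> j < \<rho> i"
  shows "inj_on f I" "\<not> rat_fun.dependent (f ` I)"
proof -
  show inj: "inj_on f I"
  proof (rule inj_onI, rule ccontr)
    fix i j assume ij: "i \<in> I" "j \<in> I" "f i = f j" "i \<noteq> j"
    have "f j (x i) \<noteq> 0" "f i (x j) \<noteq> 0"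
      using diag[OF ij(1)] diag[OF ij(2)] by (simp_all only: ij(3) not_False_eq_True)
    then have "\<rho> j < \<rho> i" "\<rho> i < \<rho> j" using tri[OF ij(1,2)] tri[OF ij(2,1)] ij(4) by blast+
    then show False by simp
  qed
  show "\<not> rat_fun.dependent (f ` I)"
  proof
    assume "rat_fun.dependent (f ` I)"
    then obtain u where u: "\<exists>v\<in>f ` I. u v \<noteq> 0" "(\<Sum>v\<in>f ` I. (\<lambda>h. u v * v h)) = 0"
      unfolding rat_fun.dependent_finite[OF finite_imageI[OF fin]] by (elim exE conjE)
    let ?N = "{i \<in> I. u (f i) \<noteq> 0}"
    have "?N \<noteq> {}" using u(1) by auto
    have finN: "finite ?N" using fin by simp
    \<comment> \<open>Minimal rank among the nonzero coefficients: at \<open>x i\<close> every other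
      term of the relation vanishes, as a nonzero \<open>f j (x i)\<close> would force
      \<open>\<rho> j < \<rho> i\<close>.\<close>
    define i where "i = arg_min_on \<rho> ?N"
    have i: "i \<in> ?N" "\<And>j. j \<in> ?N \<Longrightarrow> \<rho> i \<le> \<rho> j"
      unfolding i_def using arg_min_if_finite(1)[OF finN \<open>?N \<noteq> {}\<close>]
        arg_min_least[OF finN \<open>?N \<noteq> {}\<close>] by blast+
    have "(\<Sum>v\<in>A. (\<lambda>h. u v * v h)) y = (\<Sum>v\<in>A. u v * v y)" for A y
      by (induction A rule: infinite_finite_induct) auto
    then have "0 = (\<Sum>v\<in>f ` I. u v * v (x i))" using fun_cong[OF u(2), of "x i"] by simp
    also have "\<dots> = (\<Sum>j\<in>I. u (f j) * f j (x i))" by (simp add: sum.reindex[OF inj])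
    also have "\<dots> = (\<Sum>j\<in>I. if j = i then u (f i) * f i (x i) else 0)"
    proof (rule sum.cong[OF refl])
      fix j assume "j \<in> I"
      then show "u (f j) * f j (x i) = (if j = i then u (f i) * f i (x i) else 0)"
        using tri[of i j] i(1) i(2)[of j] by (cases "u (f j) = 0") auto
    qed
    finally show False using fin i(1) diag by simp
  qed
qed

text \<open>Membership in a finite-dimensional invariant subspace. Recording a finite spanning set
  reduces sums and products of functions to unions and pairwise products of such sets.\<close>

definition locally_finite :: "('a, 'b) monoid_scheme \<Rightarrow> ('a \<Rightarrow> rat) \<Rightarrow> bool" where
  "locally_finite G f \<longleftrightarrow> (\<exists>X. finite X \<and> X \<subseteq> dual_space G \<and> f \<in> rat_fun.span X \<and>
     (\<forall>g \<in> carrier G. \<forall>x \<in> X. dual_act G g x \<in> rat_fun.span X))"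

lemma subspace_dual_space: "rat_fun.subspace (dual_space G)"
  by (auto simp: dual_space_def rat_fun.subspace_def)

lemma dual_act_span:
  assumes "\<And>x. x \<in> X \<Longrightarrow> dual_act G g x \<in> rat_fun.span Y" "f \<in> rat_fun.span X"
  shows "dual_act G g f \<in> rat_fun.span Y"
  using assms(2)
proof (induction rule: rat_fun.span_induct_alt)
  case base
  have "dual_act G g 0 = 0" by (auto simp: dual_act_def)
  then show ?case by (simp only: rat_fun.span_zero)
next
  case (step c x y)
  have "dual_act G g ((\<lambda>h. c * x h) + y) = (\<lambda>h. c * dual_act G g x h) + dual_act G g y"
    by (auto simp: dual_act_def)
  then show ?case
    using rat_fun.span_add[OF rat_fun.span_scale[OF assms(1)[OF step(1)]] step(2)] by (simp only:)
qed

lemma times_span: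
  assumes "f \<in> rat_fun.span X" "h \<in> rat_fun.span Y"
  shows "f * h \<in> rat_fun.span {x * y | x y. x \<in> X \<and> y \<in> Y}" (is "_ \<in> rat_fun.span ?Z")
  using assms(1)
proof (induction rule: rat_fun.span_induct_alt)
  case base
  show ?case by (simp only: mult_zero_left rat_fun.span_zero)
next
  case (step c x f)
  have "x * h \<in> rat_fun.span ?Z"
    using assms(2)
  proof (induction rule: rat_fun.span_induct_alt)
    case base
    show ?case by (simp only: mult_zero_right rat_fun.span_zero)
  next
    case (step d y h)
    have "x * ((\<lambda>a. d * y a) + h) = (\<lambda>a. d * (x * y) a) + x * h"
      by (auto simp: fun_eq_iff algebra_simps)
    moreover have "x * y \<in> rat_fun.span ?Z"
      using step \<open>x \<in> X\<close> by (intro rat_fun.span_base) auto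
    ultimately show ?case using rat_fun.span_add[OF rat_fun.span_scale step(2)] by (simp only:)
  qed
  moreover have "((\<lambda>a. c * x a) + f) * h = (\<lambda>a. c * (x * h) a) + f * h"
    by (auto simp: fun_eq_iff algebra_simps)
  ultimately show ?case using rat_fun.span_add[OF rat_fun.span_scale step(2)] by (simp only:)
qed

lemma locally_finite_scale:
  "locally_finite G f \<Longrightarrow> locally_finite G (\<lambda>h. c * f h)"
  unfolding locally_finite_def using rat_fun.span_scale by blast

lemma locally_finite_add:
  assumes "locally_finite G f" "locally_finite G h"
  shows "locally_finite G (f + h)"
proof -
  obtain X Y where X: "finite X" "X \<subseteq> dual_space G" "f \<in> rat_fun.span X"
      "\<forall>g\<in>carrier G. \<forall>x\<in>X. dual_act G g x \<in> rat_fun.span X"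
    and Y: "finite Y" "Y \<subseteq> dual_space G" "h \<in> rat_fun.span Y"
      "\<forall>g\<in>carrier G. \<forall>x\<in>Y. dual_act G g x \<in> rat_fun.span Y"
    using assms unfolding locally_finite_def by blast
  have "rat_fun.span X \<subseteq> rat_fun.span (X \<union> Y)" "rat_fun.span Y \<subseteq> rat_fun.span (X \<union> Y)"
    by (simp_all add: rat_fun.span_mono)
  then have "f + h \<in> rat_fun.span (X \<union> Y)"
    "\<forall>g\<in>carrier G. \<forall>x\<in>X \<union> Y. dual_act G g x \<in> rat_fun.span (X \<union> Y)"
    using X(3,4) Y(3,4) rat_fun.span_add[of f "X \<union> Y" h] by blast+
  then show ?thesis unfolding locally_finite_def
    using X(1,2) Y(1,2) by (intro exI[of _ "X \<union> Y"] conjI) simp_all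
qed

lemma locally_finite_times:
  assumes "locally_finite G f" "locally_finite G h"
  shows "locally_finite G (f * h)"
proof -
  obtain X Y where X: "finite X" "X \<subseteq> dual_space G" "f \<in> rat_fun.span X"
      "\<forall>g\<in>carrier G. \<forall>x\<in>X. dual_act G g x \<in> rat_fun.span X"
    and Y: "finite Y" "Y \<subseteq> dual_space G" "h \<in> rat_fun.span Y"
      "\<forall>g\<in>carrier G. \<forall>x\<in>Y. dual_act G g x \<in> rat_fun.span Y"
    using assms unfolding locally_finite_def by blast
  let ?Z = "{x * y | x y. x \<in> X \<and> y \<in> Y}"
  have "dual_act G g (x * y) \<in> rat_fun.span ?Z" if "g \<in> carrier G" "x \<in> X" "y \<in> Y" for g x y
  proof -
    have "dual_act G g (x * y) = dual_act G g x * dual_act G g y"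
      by (auto simp: dual_act_def)
    then show ?thesis using times_span[of "dual_act G g x" X "dual_act G g y" Y] X(4) Y(4) that by (metis (no_types))
  qed
  moreover have "?Z \<subseteq> dual_space G" using X(2) by (auto simp: dual_space_def)
  moreover have "?Z = (\<lambda>(x, y). x * y) ` (X \<times> Y)" by auto
  then have "finite ?Z" using X(1) Y(1) by simp
  ultimately show ?thesis unfolding locally_finite_def
    using times_span[OF X(3) Y(3)] by (intro exI[of _ ?Z] conjI) blast+
qed

section \<open>Finite dimension of the Nickel module\<close>

lemma nickel_module_finite:
  assumes G: "group G"
    and lf: "\<And>i. i < length as \<Longrightarrow> locally_finite G (malcev_coord G as i)"
  obtains Y where "finite Y" "nickel_module G as \<subseteq> rat_fun.span Y"
proof -
  have "\<forall>i\<in>{..<length as}. \<exists>X. finite X \<and> X \<subseteq> dual_space G \<and> malcev_coord G as i \<in> rat_fun.span X \<and>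
     (\<forall>g \<in> carrier G. \<forall>x \<in> X. dual_act G g x \<in> rat_fun.span X)"
    using lf unfolding locally_finite_def by blast
  from bchoice[OF this] obtain X where
    "\<forall>i\<in>{..<length as}. finite (X i) \<and> X i \<subseteq> dual_space G \<and> malcev_coord G as i \<in> rat_fun.span (X i) \<and>
     (\<forall>g \<in> carrier G. \<forall>x \<in> X i. dual_act G g x \<in> rat_fun.span (X i))" ..
  then have X: "finite (X i)" "X i \<subseteq> dual_space G" "malcev_coord G as i \<in> rat_fun.span (X i)"
     "\<And>g x. g \<in> carrier G \<Longrightarrow> x \<in> X i \<Longrightarrow> dual_act G g x \<in> rat_fun.span (X i)" if "i < length as" for i
    using that by auto
  \<comment> \<open>The span of the joint spanning set is a submodule containing all coordinate
    functions, so minimality of the hull applies.\<close>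
  let ?Y = "\<Union>i<length as. X i"
  have mono: "rat_fun.span (X i) \<subseteq> rat_fun.span ?Y" if "i < length as" for i
    using that by (intro rat_fun.span_mono) auto
  have "dual_act G g f \<in> rat_fun.span ?Y" if "g \<in> carrier G" "f \<in> rat_fun.span ?Y" for g f
  proof (rule dual_act_span[OF _ that(2)])
    fix x assume "x \<in> ?Y"
    then obtain i where i: "i < length as" "x \<in> X i" by auto
    then show "dual_act G g x \<in> rat_fun.span ?Y" using subsetD[OF mono X(4)[OF _ that(1)]] by blast
  qed
  moreover have "rat_fun.span ?Y \<subseteq> dual_space G"
    by (rule rat_fun.span_minimal[OF _ subspace_dual_space]) (use X(2) in auto)
  ultimately have "dual_submodule G (rat_fun.span ?Y)"
    unfolding dual_submodule_def using rat_fun.subspace_span by blast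
  then have "nickel_module G as \<subseteq> rat_fun.span ?Y"
    unfolding nickel_module_def using subsetD[OF mono X(3)] by (intro hull_minimal) blast+
  then show ?thesis using X(1) by (intro that[of ?Y]) auto
qed

text \<open>An infinite basis would have \<open>card\<close> 0, so the basis \<open>C\<close> is
  first shown finite by means of the finite spanning set \<open>Y\<close>; then independent sets can
  be compared with it.\<close>

lemma nickel_dim_ge:
  assumes G: "group G"
    and lf: "\<And>i. i < length as \<Longrightarrow> locally_finite G (malcev_coord G as i)"
    and S: "S \<subseteq> nickel_module G as" "\<not> rat_fun.dependent S"
  shows "card S \<le> nickel_dim G as"
proof -
  obtain Y where Y: "finite Y" "nickel_module G as \<subseteq> rat_fun.span Y"
    by (rule nickel_module_finite[of G as]) (use G lf in auto)
  obtain C where C: "C \<subseteq> nickel_module G as" "\<not> rat_fun.dependent C"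
    "nickel_module G as \<subseteq> rat_fun.span C" "card C = nickel_dim G as"
    unfolding nickel_dim_def by (rule rat_fun.basis_exists)
  have "finite C" using rat_fun.independent_span_bound[OF Y(1) C(2)] C(1) Y(2) by blast
  then show ?thesis using rat_fun.independent_span_bound[of C S] S C(3,4) by (metis order_trans)
qed

lemma malcev_coord_in_nickel_module: "i < length as \<Longrightarrow> malcev_coord G as i \<in> nickel_module G as"
  unfolding nickel_module_def by (rule hull_subset[THEN subsetD]) auto

section \<open>Computing the coordinates\<close>

text \<open>If \<open>B\<close> is the inverse of a product of basis powers, each factor cancels the
  leading power, leaving the inverse of the remaining product. Multiplying on the right makes each
  step a column operation.\<close>

definition peel :: "nat \<Rightarrow> (nat \<times> nat) list \<Rightarrow> int mat \<Rightarrow> int mat" where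
  "peel m us B = foldl (\<lambda>B p. B * trans_mat m p (- (B $$ p))) B us"

lemma peel_Nil [simp]: "peel m [] B = B"
  and peel_Cons: "peel m (p # us) B = peel m us (B * trans_mat m p (- (B $$ p)))"
  and peel_append: "peel m (us @ vs) B = peel m vs (peel m us B)"
  by (simp_all add: peel_def)

lemma mult_trans_mat_entry:
  assumes "B \<in> carrier_mat m m" "r < m" "c < m" "i < j" "j < m"
  shows "(B * trans_mat m (i, j) x) $$ (r, c) = B $$ (r, c) + (if c = j then B $$ (r, i) * x else 0)"
proof -
  have "(B * trans_mat m (i, j) x) $$ (r, c) =
      (\<Sum>l\<in>{0..<m}. B $$ (r, l) * trans_mat m (i, j) x $$ (l, c))"
    using assms by (auto simp: scalar_prod_def trans_mat_def)
  also have "\<dots> = (\<Sum>l\<in>{0..<m}. (if l = c then B $$ (r, l) else 0) + (if l = i then (if c = j then B $$ (r, l) * x else 0) else 0))"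
    by (rule sum.cong[OF refl]) (use assms in \<open>auto simp: trans_mat_def\<close>)
  finally show ?thesis using assms by (simp add: sum.distrib)
qed

text \<open>At \<open>p\<close> the entries of the two factors add up, so the exponent
  \<open>- (B $$ p)\<close> clears it; earlier zeros survive because \<open>zero_on m us\<close> is
  closed under products.\<close>

lemma peel_step:
  assumes "std_positions m = us @ p # vs" "B \<in> zero_on m us"
  shows "B * trans_mat m p (- (B $$ p)) \<in> zero_on m (us @ [p])"
proof -
  let ?T = "trans_mat m p (- (B $$ p))"
  have T: "?T \<in> zero_on m us" "?T $$ p = - (B $$ p)" using trans_mat_zero_on[OF assms(1)] by auto
  have "(B * ?T) $$ p = 0"
    using zero_on_mult_entry[OF assms(1), of B ?T] T assms(2) by (auto simp: zero_on_def)
  then show ?thesis using zero_on_mult[OF assms(1,2) T(1)] by (simp add: zero_on_snoc)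
qed

lemma peel_zero_on:
  "std_positions m = us @ vs \<Longrightarrow> B \<in> carrier (UT m) \<Longrightarrow> peel m us B \<in> zero_on m us"
proof (induction us arbitrary: vs rule: rev_induct)
  case Nil
  then show ?case by (simp add: zero_on_Nil)
next
  case (snoc p us)
  then show ?case using peel_step[of m us p vs] by (simp add: peel_append peel_Cons)
qed

text \<open>At the first position the entries add up and the later factors contribute 0, which
  forces \<open>x = - (B $$ p)\<close>. Absorbing that power into \<open>B\<close> leaves the same
  situation with one position fewer.\<close>

lemma trans_prod_peel:
  "std_positions m = us @ vs \<Longrightarrow> length xs = length vs \<Longrightarrow> B \<in> zero_on m us \<Longrightarrow>
    B * trans_prod m vs xs = 1\<^sub>m m \<Longrightarrow> k < length vs \<Longrightarrow> xs ! k = - (peel m (take k vs) B $$ (vs ! k))"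
proof (induction vs arbitrary: us xs B k)
  case (Cons p vs)
  obtain x ys where xs: "xs = x # ys" "length ys = length vs" using Cons.prems(2) by (cases xs) auto
  have ps: "std_positions m = (us @ [p]) @ vs" using Cons.prems by simp
  obtain i j where p: "p = (i, j)" by (cases p)
  have ij: "i < j" "j < m" using std_positions_set[of m] Cons.prems(1) p by auto
  let ?A = "trans_prod m vs ys"
  note T = trans_mat_zero_on[OF Cons.prems(1), of x]
  have A: "?A \<in> zero_on m us" "?A $$ p = 0" using trans_prod_zero_on[OF ps xs(2)] by (auto simp: zero_on_snoc)
  have TA: "trans_mat m p x * ?A \<in> zero_on m us" using zero_on_mult[OF Cons.prems(1) T(1) A(1)] .
  have "(trans_mat m p x * ?A) $$ p = x"
    using zero_on_mult_entry[OF Cons.prems(1), of "trans_mat m p x" ?A] T A by (auto simp: zero_on_def)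
  moreover have "(B * (trans_mat m p x * ?A)) $$ p = B $$ p + (trans_mat m p x * ?A) $$ p"
    using zero_on_mult_entry[OF Cons.prems(1), of B "trans_mat m p x * ?A"] TA Cons.prems(3)
    by (auto simp: zero_on_def)
  ultimately have x: "x = - (B $$ p)" using Cons.prems(4) ij by (simp add: xs p)
  show ?case
  proof (cases k)
    case 0
    then show ?thesis using x xs by simp
  next
    case (Suc l)
    have "(B * trans_mat m p x) * ?A = 1\<^sub>m m"
      using Cons.prems(3,4) A(1) assoc_mult_mat[of B m m "trans_mat m p x" m ?A m]
      by (auto simp: xs zero_on_def UT_iff trans_mat_def)
    then show ?thesis
      using Cons.IH[OF ps xs(2), of "B * trans_mat m p x" l] peel_step[OF Cons.prems(1,3)] Cons.prems(5) Suc x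
      by (simp add: xs peel_Cons)
  qed
qed simp

text \<open>Passing to the inverse separates the two actions: translation by \<open>g\<close>
  multiplies it by \<open>g\<close> on the left, peeling works on the right.\<close>

lemma malcev_coord_UT:
  assumes A: "A \<in> carrier (UT m)" and k: "k < length (std_positions m)"
  shows "malcev_coord (UT m) (std_malcev_basis m) k A =
    of_int (- (peel m (take k (std_positions m)) (inv\<^bsub>UT m\<^esub> A) $$ (std_positions m ! k)))"
proof -
  interpret group "UT m" by (rule group_UT)
  let ?ps = "std_positions m"
  obtain xs where xs: "length xs = length ?ps" "trans_prod m ?ps xs = A"
    using trans_prod_exists[of m "[]" ?ps A] A by (auto simp: zero_on_Nil)
  have mp: "malcev_prod (UT m) (std_malcev_basis m) xs = A"
    unfolding std_malcev_basis_def by (simp add: malcev_prod_eq xs)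
  have "malcev_coord (UT m) (std_malcev_basis m) k A = of_int (xs ! k)"
    using malcev_coord_prod[OF malcev_basis_UT, of m xs k] A xs(1)
    unfolding mp by (simp add: std_malcev_basis_def)
  moreover have "inv\<^bsub>UT m\<^esub> A * trans_prod m ?ps xs = 1\<^sub>m m" using l_inv[OF A] by (simp add: xs(2))
  then have "xs ! k = - (peel m (take k ?ps) (inv\<^bsub>UT m\<^esub> A) $$ (?ps ! k))"
    using trans_prod_peel[of m "[]" ?ps xs "inv\<^bsub>UT m\<^esub> A" k] xs(1) k A by (simp add: zero_on_Nil)
  ultimately show ?thesis by simp
qed

section \<open>Polynomial dependence of the coordinates on the inverse\<close>

lemma peel_snoc_entry:
  assumes "std_positions m = us @ (i, j) # vs" "B \<in> carrier (UT m)" "r < m" "c < m"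
  shows "peel m (us @ [(i, j)]) B $$ (r, c) =
    peel m us B $$ (r, c) - (if c = j then peel m us B $$ (r, i) * peel m us B $$ (i, j) else 0)"
proof -
  have ij: "i < j" "j < m" using std_positions_set[of m] assms(1) by auto
  have "peel m us B \<in> carrier_mat m m" using peel_zero_on[OF assms(1,2)] by (auto simp: zero_on_def UT_iff)
  then show ?thesis using mult_trans_mat_entry[of "peel m us B" m r c i j] assms ij
    by (simp add: peel_append peel_Cons)
qed

text \<open>Entries of \<open>g\<close> times the inverse are linear combinations of entries in the
  same column of the inverse, so each column spans an invariant space. Peeling then forms
  polynomials in these entries.\<close>

lemma locally_finite_peel:
  assumes "std_positions m = us @ vs" "r < m" "c < m"
  shows "locally_finite (UT m)
    (\<lambda>A. if A \<in> carrier (UT m) then of_int (peel m us (inv\<^bsub>UT m\<^esub> A) $$ (r, c)) else 0)"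
  using assms
proof (induction us arbitrary: vs r c rule: rev_induct)
  case Nil
  interpret group "UT m" by (rule group_UT)
  let ?e = "\<lambda>r A. if A \<in> carrier (UT m) then rat_of_int ((inv\<^bsub>UT m\<^esub> A) $$ (r, c)) else 0"
  let ?X = "?e ` {0..<m}"
  have "dual_act (UT m) g (?e s) \<in> rat_fun.span ?X" if g: "g \<in> carrier (UT m)" and s: "s < m" for g s
  proof -
    have "dual_act (UT m) g (?e s) = (\<Sum>l\<in>{0..<m}. (\<lambda>A. of_int (g $$ (s, l)) * ?e l A))"
    proof
      fix A
      have app: "(\<Sum>l\<in>L. (\<lambda>A. of_int (g $$ (s, l)) * ?e l A)) A = (\<Sum>l\<in>L. of_int (g $$ (s, l)) * ?e l A)" for L
        by (induction L rule: infinite_finite_induct) auto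
      show "dual_act (UT m) g (?e s) A = (\<Sum>l\<in>{0..<m}. (\<lambda>A. of_int (g $$ (s, l)) * ?e l A)) A"
      proof (cases "A \<in> carrier (UT m)")
        case True
        have "inv\<^bsub>UT m\<^esub> (A * inv\<^bsub>UT m\<^esub> g) = g * inv\<^bsub>UT m\<^esub> A"
          using inv_mult_group[of A "inv\<^bsub>UT m\<^esub> g"] True g by simp
        moreover have "A * inv\<^bsub>UT m\<^esub> g \<in> carrier (UT m)" using True g UT_closed by simp
        moreover have "inv\<^bsub>UT m\<^esub> A \<in> carrier (UT m)" using True by simp
        then have "(g * inv\<^bsub>UT m\<^esub> A) $$ (s, c) = (\<Sum>l\<in>{0..<m}. g $$ (s, l) * (inv\<^bsub>UT m\<^esub> A) $$ (l, c))"
          using g s Nil by (auto simp: UT_iff scalar_prod_def)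
        ultimately show ?thesis unfolding app using True by (simp add: dual_act_def)
      next
        case False
        then show ?thesis unfolding app by (simp add: dual_act_def)
      qed
    qed
    also have "\<dots> \<in> rat_fun.span ?X"
      by (intro rat_fun.span_sum rat_fun.span_scale rat_fun.span_base) auto
    finally show ?thesis .
  qed
  moreover have "?e r \<in> rat_fun.span ?X" by (rule rat_fun.span_base) (use Nil in simp)
  moreover have "?X \<subseteq> dual_space (UT m)" by (auto simp: dual_space_def)
  ultimately show ?case unfolding locally_finite_def peel_Nil
    by (intro exI[of _ ?X]) simp
next
  case (snoc p us)
  interpret group "UT m" by (rule group_UT)
  obtain i j where p: "p = (i, j)" by (cases p)
  have ps: "std_positions m = us @ (i, j) # vs" using snoc.prems p by simp
  have ij: "i < j" "j < m" using std_positions_set[of m] ps by auto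
  let ?e = "\<lambda>r c A. if A \<in> carrier (UT m) then rat_of_int (peel m us (inv\<^bsub>UT m\<^esub> A) $$ (r, c)) else 0"
  have IH: "locally_finite (UT m) (?e r c)" if "r < m" "c < m" for r c
    using snoc.IH[OF ps that] .
  \<comment> \<open>The coefficient 0 or -1 covers untouched columns and column \<open>j\<close> by
    one formula.\<close>
  have "(\<lambda>A. if A \<in> carrier (UT m) then rat_of_int (peel m (us @ [p]) (inv\<^bsub>UT m\<^esub> A) $$ (r, c)) else 0) =
      ?e r c + (\<lambda>A. (if c = j then -1 else 0) * (?e r i * ?e i j) A)"
    using peel_snoc_entry[OF ps _ snoc.prems(2,3)] by (auto simp: fun_eq_iff p)
  then show ?case
    using IH ij snoc.prems by (simp only:) (intro locally_finite_add locally_finite_scale locally_finite_times; simp)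
qed

lemma locally_finite_malcev_coord:
  assumes "k < length (std_malcev_basis m)"
  shows "locally_finite (UT m) (malcev_coord (UT m) (std_malcev_basis m) k)"
proof -
  let ?ps = "std_positions m"
  have k: "k < length ?ps" using assms by (simp add: std_malcev_basis_def)
  obtain i j where ij: "?ps ! k = (i, j)" by (cases "?ps ! k")
  have "(i, j) \<in> set ?ps" using k ij by (metis nth_mem)
  then have "i < m" "j < m" by (auto simp: std_positions_set)
  then have "locally_finite (UT m) (\<lambda>A. (- 1) *
    (if A \<in> carrier (UT m) then of_int (peel m (take k ?ps) (inv\<^bsub>UT m\<^esub> A) $$ (i, j)) else 0))"
    by (intro locally_finite_scale locally_finite_peel[of _ _ "drop k ?ps"]) auto
  moreover have "malcev_coord (UT m) (std_malcev_basis m) k = (\<lambda>A. (- 1) *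
    (if A \<in> carrier (UT m) then of_int (peel m (take k ?ps) (inv\<^bsub>UT m\<^esub> A) $$ (i, j)) else 0))"
    using malcev_coord_UT[OF _ k] by (auto simp: fun_eq_iff ij malcev_coord_def)
  ultimately show ?thesis by simp
qed

section \<open>The coordinate in the upper right corner\<close>

text \<open>The factors 1 - b and 1 - a of the overview. With the minus sign, a partition gives a
  superdiagonal of -1, so that peeling it adds columns.\<close>

definition step_mat :: "nat \<Rightarrow> nat set \<Rightarrow> int mat" where
  "step_mat m P = mat m m (\<lambda>(r, c). if c = r then 1 else if c = Suc r \<and> r \<in> P then - 1 else 0)"

lemma step_mat_UT: "step_mat m P \<in> carrier (UT m)"
  by (auto simp: UT_iff step_mat_def)

text \<open>Expand (1 - b) (1 - a) = 1 - a - b + b a; the term b a lives on the second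
  superdiagonal.\<close>

lemma step_mat_mult_entry:
  assumes "r < m" "c < m"
  shows "(step_mat m P * step_mat m Q) $$ (r, c) =
    (if c = r then 1 else 0) - (if c = Suc r \<and> r \<in> Q then 1 else 0) - (if c = Suc r \<and> r \<in> P then 1 else 0)
    + (if c = Suc (Suc r) \<and> r \<in> P \<and> Suc r \<in> Q then 1 else 0)"
proof -
  have "(step_mat m P * step_mat m Q) $$ (r, c) =
      (\<Sum>l\<in>{0..<m}. step_mat m P $$ (r, l) * step_mat m Q $$ (l, c))"
    using assms by (auto simp: scalar_prod_def step_mat_def)
  also have "\<dots> = (\<Sum>l\<in>{0..<m}. (if l = r then step_mat m Q $$ (l, c) else 0)
      + (if l = Suc r then (if r \<in> P then - step_mat m Q $$ (l, c) else 0) else 0))"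
    by (rule sum.cong[OF refl]) (use assms in \<open>auto simp: step_mat_def\<close>)
  also have "\<dots> = step_mat m Q $$ (r, c) +
      (if Suc r < m then (if r \<in> P then - step_mat m Q $$ (Suc r, c) else 0) else 0)"
    using assms by (simp add: sum.distrib)
  finally show ?thesis using assms by (auto simp: step_mat_def)
qed

lemma std_positions_before:
  assumes "std_positions m = us @ (i, j) # vs" "i' < j'" "j' < m"
    and "j' - i' < j - i \<or> j' - i' = j - i \<and> i' < i"
  shows "(i', j') \<in> set us"
proof -
  let ?lt = "\<lambda>(i, j) (i', j'). j - i < j' - i' \<or> j - i = j' - i' \<and> i < (i' :: nat)"
  have "sorted_wrt ?lt (concat (map (\<lambda>d. map (\<lambda>i. (i, i + d)) [0..<m - d]) [Suc 0..<n]))" for n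
    by (induction n) (auto simp: sorted_wrt_append sorted_wrt_map)
  then have "sorted_wrt ?lt (std_positions m)" by (simp add: std_positions_def)
  moreover have "(i', j') \<in> set (std_positions m)" using assms(2,3) by (simp add: std_positions_set)
  ultimately show ?thesis using assms(4) unfolding assms(1) by (auto simp: sorted_wrt_append)
qed

definition superdiag :: "nat \<Rightarrow> (nat \<times> nat) list" where
  "superdiag k = map (\<lambda>i. (i, Suc i)) [0..<k]"

lemma std_positions_superdiag:
  assumes "m \<ge> 2"
  obtains ps where "std_positions m = superdiag (m - 1) @ ps" "\<And>i j. (i, j) \<in> set ps \<longleftrightarrow> Suc i < j \<and> j < m"
proof
  let ?ps = "concat (map (\<lambda>d. map (\<lambda>i. (i, i + d)) [0..<m - d]) [2..<m])"
  have "[1..<m] = 1 # [2..<m]" using assms by (simp add: upt_conv_Cons numeral_2_eq_2)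
  then show "std_positions m = superdiag (m - 1) @ ?ps" by (simp add: std_positions_def superdiag_def)
  fix i j
  have "\<exists>d\<in>{2..<m}. (i, j) \<in> (\<lambda>i. (i, i + d)) ` {0..<m - d}" if "Suc i < j" "j < m"
    using that by (intro bexI[of _ "j - i"]) auto
  then show "(i, j) \<in> set ?ps \<longleftrightarrow> Suc i < j \<and> j < m" by auto
qed

text \<open>When \<open>(k, Suc k)\<close> is reached, column \<open>Suc k\<close> is still original
  and column \<open>k\<close> already holds the prefix sums of the rows; the entry -1 makes the step
  add the latter to the former.\<close>

lemma peel_superdiag_entry:
  assumes B: "B \<in> carrier (UT m)" and d: "\<And>r. Suc r < m \<Longrightarrow> B $$ (r, Suc r) = - 1"
    and m: "m \<ge> 2" and rc: "r < m" "c < m" and k: "k < m"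
  shows "peel m (superdiag k) B $$ (r, c) = (if c \<le> k then (\<Sum>l\<le>c. B $$ (r, l)) else B $$ (r, c))"
  using k rc
proof (induction k arbitrary: r c)
  case 0
  then show ?case by (simp add: superdiag_def)
next
  case (Suc k)
  obtain ps where ps: "std_positions m = superdiag (m - 1) @ ps"
    using std_positions_superdiag[OF m] by metis
  have "[0..<m - 1] = [0..<k] @ k # [Suc k..<m - 1]"
    using Suc.prems(1) upt_add_eq_append[of 0 k "m - 1 - k"] by (simp add: upt_conv_Cons)
  then have split: "std_positions m = superdiag k @ (k, Suc k) # map (\<lambda>i. (i, Suc i)) [Suc k..<m - 1] @ ps"
    by (simp add: ps superdiag_def)
  have "superdiag (Suc k) = superdiag k @ [(k, Suc k)]" by (simp add: superdiag_def)
  then show ?case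
    using peel_snoc_entry[OF split B, of r c] Suc.IH[of r c] Suc.IH[of r k] Suc.IH[of k "Suc k"] Suc.prems d[of k]
    by auto
qed

text \<open>A correction in a column \<open>j > k\<close> is a product of the entries at
  \<open>(r, i)\<close> and \<open>(i, j)\<close>: the first lies in the zero block if
  \<open>i > k\<close>, the second if \<open>i \<le> k\<close>.\<close>

lemma peel_block:
  assumes "std_positions m = us @ vs" "B \<in> carrier (UT m)"
    and "\<And>r c. r \<le> k \<Longrightarrow> k < c \<Longrightarrow> c < m \<Longrightarrow> B $$ (r, c) = 0"
    and "r \<le> k" "k < c" "c < m"
  shows "peel m us B $$ (r, c) = 0"
  using assms(1,4-)
proof (induction us arbitrary: vs r c rule: rev_induct)
  case Nil
  then show ?case using assms(3) by simp
next
  case (snoc p us)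
  obtain i j where p: "p = (i, j)" by (cases p)
  have ps: "std_positions m = us @ (i, j) # vs" using snoc.prems p by simp
  have ij: "i < j" "j < m" using std_positions_set[of m] ps by auto
  have "peel m us B $$ (r, c) = 0" using snoc.IH[OF ps snoc.prems(2-)] .
  moreover have "peel m us B $$ (r, i) * peel m us B $$ (i, j) = 0" if "c = j"
    using snoc.IH[OF ps, of i j] snoc.IH[OF ps, of r i] snoc.prems ij that by (cases "i \<le> k") auto
  ultimately show ?case
    using peel_snoc_entry[OF ps assms(2), of r c] snoc.prems by (simp add: p)
qed

lemma peel_corner:
  assumes m: "m \<ge> 3" and PQ: "P \<inter> Q = {}" "P \<union> Q = {..<m - 1}" "0 \<in> P" "1 \<in> Q"
    and P: "\<And>i. i \<in> P \<Longrightarrow> i + 2 < m \<Longrightarrow> 2 * i < m"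
    and ps: "std_positions m = (superdiag (m - 1) @ ws) @ (0, m - 1) # zs"
  shows "peel m (superdiag (m - 1) @ ws) (step_mat m P * step_mat m Q) $$ (0, m - 1) = 1"
proof -
  let ?d = "superdiag (m - 1)"
  define B where "B = step_mat m P * step_mat m Q"
  have B: "B \<in> carrier (UT m)" unfolding B_def by (intro UT_closed step_mat_UT)
  have mem: "r \<in> P \<longleftrightarrow> r \<notin> Q" if "Suc r < m" for r
  proof -
    have "r \<in> P \<union> Q" unfolding PQ(2) using that by simp
    then show ?thesis using PQ(1) by blast
  qed
  have Bd: "B $$ (r, Suc r) = - 1" if "Suc r < m" for r
    using that mem[OF that] by (simp add: B_def step_mat_mult_entry)
  have sum: "peel m ?d B $$ (r, c) = (\<Sum>l\<le>c. B $$ (r, l))" if "r < m" "c < m" for r c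
    using peel_superdiag_entry[OF B Bd _ that, of "m - 1"] m that by auto
  \<comment> \<open>Exactly one of \<open>P\<close> and \<open>Q\<close> contains \<open>r\<close>,
    so row \<open>r\<close> reads 1, -1 from the diagonal on, with a possible 1 after that; the
    first two cancel in the prefix sums.\<close>
  have row: "(\<Sum>l\<le>c. B $$ (r, l)) = (if r \<in> P \<and> Suc r \<in> Q \<and> Suc (Suc r) \<le> c then 1 else 0)"
    if "r < c" "c < m" for r c
  proof -
    have r: "r \<in> P \<longleftrightarrow> r \<notin> Q" using that by (intro mem) simp
    have "(\<Sum>l\<le>c. B $$ (r, l)) = (\<Sum>l\<le>c. (if l = r then 1 else 0) - (if l = Suc r then 1 else 0)
        + (if l = Suc (Suc r) then (if r \<in> P \<and> Suc r \<in> Q then 1 else 0) else 0))"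
      by (rule sum.cong[OF refl]) (use that r in \<open>auto simp: B_def step_mat_mult_entry\<close>)
    then show ?thesis using that by (simp add: sum.distrib sum_subtractf)
  qed
  \<comment> \<open>Triviality of the rows outside \<open>P\<close> is carried along to kill corner
    corrections. The corner position is excluded, since processing it would clear the entry.\<close>
  have "(\<forall>r c. r \<notin> P \<longrightarrow> r < c \<longrightarrow> c < m \<longrightarrow> peel m (?d @ us) B $$ (r, c) = 0) \<and>
      peel m (?d @ us) B $$ (0, m - 1) = 1"
    if "std_positions m = (?d @ us) @ vs" "(0, m - 1) \<notin> set us" for us vs
    using that
  proof (induction us arbitrary: vs rule: rev_induct)
    case Nil
    then show ?case using sum row PQ(3,4) m by auto
  next
    case (snoc p us)
    obtain i j where p: "p = (i, j)" by (cases p)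
    have ps: "std_positions m = (?d @ us) @ (i, j) # vs" using snoc.prems p by simp
    obtain qs where qs: "std_positions m = ?d @ qs" "\<And>i j. (i, j) \<in> set qs \<longleftrightarrow> Suc i < j \<and> j < m"
      using std_positions_superdiag[of m] m by auto
    have "qs = us @ (i, j) # vs" using qs(1) ps by simp
    then have ij: "Suc i < j" "j < m" using qs(2)[of i j] by auto
    let ?C = "peel m (?d @ us) B"
    have C: "?C \<in> zero_on m (?d @ us)" using peel_zero_on[OF ps B] .
    have IH: "\<And>r c. r \<notin> P \<Longrightarrow> r < c \<Longrightarrow> c < m \<Longrightarrow> ?C $$ (r, c) = 0" "?C $$ (0, m - 1) = 1"
      using snoc.IH[OF ps] snoc.prems(2) by auto
    have entry: "peel m (?d @ us @ [p]) B $$ (r, c) =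
        ?C $$ (r, c) - (if c = j then ?C $$ (r, i) * ?C $$ (i, j) else 0)" if "r < m" "c < m" for r c
      using peel_snoc_entry[OF ps B that] by (simp add: p)
    have "peel m (?d @ us @ [p]) B $$ (r, c) = 0" if r: "r \<notin> P" "r < c" "c < m" for r c
    proof -
      \<comment> \<open>For \<open>r < i\<close> the first factor vanishes by induction, for
        \<open>r = i\<close> the second, and for \<open>r > i\<close> the first by
        triangularity.\<close>
      have "?C $$ (r, i) * ?C $$ (i, j) = 0"
        using C ij IH(1)[of r i] IH(1)[of r j] r
        by (cases r i rule: linorder_cases) (auto simp: zero_on_def UT_iff)
      then show ?thesis using entry[of r c] r IH(1) by auto
    qed
    moreover have "peel m (?d @ us @ [p]) B $$ (0, m - 1) = 1"
    proof -
      have "?C $$ (0, i) * ?C $$ (i, j) = 0" if j: "j = m - 1"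
      proof (cases "2 * i < m")
        case True
        have "0 < i" using snoc.prems(2) p j by auto
        \<comment> \<open>Here \<open>i \<le> m - 1 - i\<close>; in case of equality,
          \<open>0 < i\<close> still places \<open>(0, i)\<close> first.\<close>
        then have "(0, i) \<in> set (?d @ us)"
          using True j ij by (intro std_positions_before[OF ps]) auto
        then show ?thesis using C by (auto simp: zero_on_def)
      next
        case False
        \<comment> \<open>Past the superdiagonal \<open>i + 2 < m\<close>, so the assumption on
          \<open>P\<close> excludes \<open>i\<close> from \<open>P\<close> and row \<open>i\<close>
          is trivial.\<close>
        then show ?thesis using P[of i] IH(1)[of i j] ij j by auto
      qed
      then show ?thesis using entry[of 0 "m - 1"] IH(2) m by auto
    qed
    ultimately show ?case by simp
  qed
  moreover have "(0, m - 1) \<notin> set ws" using std_positions_prefix(1)[OF ps] by simp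
  ultimately show ?thesis using ps unfolding B_def by blast
qed

section \<open>Translates of the corner coordinate indexed by subsets\<close>

theorem theorem3p9:
  fixes m :: nat
  assumes "m \<ge> 2"
  shows "nickel_dim (UT m) (std_malcev_basis m) \<ge> 2 ^ (m div 2 - 1)"
proof -
  interpret group "UT m" by (rule group_UT)
  let ?G = "UT m" and ?as = "std_malcev_basis m"
  let ?t = "malcev_coord ?G ?as"
  obtain ps where ps: "std_positions m = superdiag (m - 1) @ ps" "\<And>i j. (i, j) \<in> set ps \<longleftrightarrow> Suc i < j \<and> j < m"
    using std_positions_superdiag[OF assms] by auto
  have len: "length ?as = length (std_positions m)" by (simp add: std_malcev_basis_def)
  have len0: "0 < length ?as" using assms unfolding len by (simp add: ps superdiag_def)
  note dim = nickel_dim_ge[OF group_UT locally_finite_malcev_coord]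
  show ?thesis
  proof (cases "m \<ge> 4")
    case False
    \<comment> \<open>The bound is 1 here, so one nonzero coordinate function suffices.\<close>
    let ?xs = "replicate (length ?as) 1"
    have "malcev_prod ?G ?as ?xs \<in> carrier ?G"
      using trans_prod_zero_on[of m "[]" "std_positions m" ?xs]
      by (simp add: zero_on_Nil len malcev_prod_eq std_malcev_basis_def)
    then have "?t 0 (malcev_prod ?G ?as ?xs) \<noteq> 0"
      using malcev_coord_prod[OF malcev_basis_UT, of m ?xs 0] len0 by simp
    then have "\<not> rat_fun.dependent {?t 0}" by (auto simp: rat_fun.dependent_single)
    then have "card {?t 0} \<le> nickel_dim ?G ?as"
      using malcev_coord_in_nickel_module[OF len0] by (intro dim) auto
    moreover have "m div 2 - 1 = 0" using False by auto
    ultimately show ?thesis by simp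
  next
    case True
    define n where "n = m - 1"
    have n: "n \<ge> 3" "m = Suc n" using True by (auto simp: n_def)
    have "(0, n) \<in> set ps" using ps(2) n by simp
    then obtain ws zs where "ps = ws @ (0, n) # zs" by (meson split_list)
    then have split: "std_positions m = (superdiag (m - 1) @ ws) @ (0, m - 1) # zs"
      using ps(1) by (simp add: n_def)
    define us where "us = superdiag (m - 1) @ ws"
    define k where "k = length us"
    have k: "k < length ?as" "take k (std_positions m) = us" "std_positions m ! k = (0, m - 1)"
      unfolding len by (simp_all add: split k_def us_def)
    \<comment> \<open>The free indices. Besides those up to \<open>n div 2\<close>,
      \<open>n - 1\<close> may lie in \<open>P\<close>, because \<open>(n - 1, n)\<close> is on the
      superdiagonal; 0 and 1 are reserved for \<open>P\<close> and \<open>Q\<close>.\<close>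
    define F where "F = {2..n div 2} \<union> {n - 1}"
    \<comment> \<open>\<open>P T\<close> and \<open>Q T\<close> partition \<open>{..<n}\<close>,
      whereas an index in \<open>T - S\<close> lies in neither \<open>P T\<close> nor
      \<open>Q S\<close>.\<close>
    define P where "P T = insert 0 (F - T)" for T
    define Q where "Q S = ({1..<n} - F) \<union> S" for S
    define f where "f T = dual_act ?G (step_mat m (P T)) (?t k)" for T
    \<comment> \<open>Inverted so that translating by \<open>g\<close> yields an argument with
      inverse \<open>g * step_mat m (Q S)\<close>.\<close>
    define x where "x S = inv\<^bsub>?G\<^esub> step_mat m (Q S)" for S
    have F: "F \<subseteq> {2..<n}" "finite F" "card F = n div 2"
    proof -
      have "n div 2 < n - 1" using n by linarith
      then show "F \<subseteq> {2..<n}" "finite F" "card F = n div 2" using n by (auto simp: F_def)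
    qed
    have fx: "f T (x S) = of_int (- (peel m us (step_mat m (P T) * step_mat m (Q S)) $$ (0, m - 1)))" for S T
    proof -
      let ?g = "step_mat m (P T)" and ?h = "step_mat m (Q S)"
      have gh: "?g \<in> carrier ?G" "?h \<in> carrier ?G" "x S \<in> carrier ?G"
        by (simp_all add: step_mat_UT x_def)
      have "inv\<^bsub>?G\<^esub> (x S * inv\<^bsub>?G\<^esub> ?g) = ?g * ?h"
        using inv_mult_group[of "x S" "inv\<^bsub>?G\<^esub> ?g"] gh by (simp add: x_def)
      moreover have "x S * inv\<^bsub>?G\<^esub> ?g \<in> carrier ?G" using gh by (intro UT_closed) simp_all
      ultimately show ?thesis
        using malcev_coord_UT[of "x S * inv\<^bsub>?G\<^esub> ?g" m k] k len gh by (simp add: f_def dual_act_def)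
    qed
    have diag: "f T (x T) \<noteq> 0" if "T \<in> Pow F" for T
    proof -
      have "peel m us (step_mat m (P T) * step_mat m (Q T)) $$ (0, m - 1) = 1"
        unfolding us_def
      proof (rule peel_corner[OF _ _ _ _ _ _ split])
        show "2 * i < m" if "i \<in> P T" "i + 2 < m" for i
          using that n by (auto simp: P_def F_def)
      qed (use n F that in \<open>auto simp: P_def Q_def\<close>)
      then show ?thesis by (simp add: fx)
    qed
    have tri: "S = T \<or> card T < card S" if "S \<in> Pow F" "T \<in> Pow F" "f T (x S) \<noteq> 0" for S T
    proof -
      have "T \<subseteq> S"
      proof
        fix c assume "c \<in> T"
        show "c \<in> S"
        proof (rule ccontr)
          assume "c \<notin> S"
          then have c: "c \<notin> P T" "c \<notin> Q S" "c < n"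
            using \<open>c \<in> T\<close> F(1) that(2) by (auto simp: P_def Q_def)
          \<comment> \<open>An entry crossing the cut after \<open>c\<close> lies on the first
            superdiagonal in row \<open>c\<close>, or on the second with \<open>c\<close> as its row
            or the next one; both need \<open>c\<close> in \<open>P T\<close> or
            \<open>Q S\<close>.\<close>
          have "(step_mat m (P T) * step_mat m (Q S)) $$ (r, l) = 0" if "r \<le> c" "c < l" "l < m" for r l
          proof -
            have "r \<notin> P T \<and> r \<notin> Q S \<or> l \<noteq> Suc r"
              using that(1,2) c(1,2) by (cases "r = c") auto
            moreover have "r \<notin> P T \<or> Suc r \<notin> Q S \<or> l \<noteq> Suc (Suc r)"
            proof (cases "r = c \<or> Suc r = c")
              case True
              then show ?thesis using c(1,2) by blast
            next
              case False
              then show ?thesis using that(1,2) by simp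
            qed
            ultimately show ?thesis using that by (auto simp: step_mat_mult_entry)
          qed
          then have "peel m us (step_mat m (P T) * step_mat m (Q S)) $$ (0, m - 1) = 0"
            using c n split by (intro peel_block[of m us "(0, m - 1) # zs" _ c])
              (auto simp: us_def intro: UT_closed step_mat_UT)
          then show False using that(3) by (simp add: fx)
        qed
      qed
      moreover have "finite S" using that(1) F(2) finite_subset by auto
      ultimately show ?thesis using psubset_card_mono by blast
    qed
    have ind: "inj_on f (Pow F)" "\<not> rat_fun.dependent (f ` Pow F)"
      using triangular_independent[of "Pow F" f x card] diag tri F(2) by auto
    have "f T \<in> nickel_module ?G ?as" for T
      using dual_submodule_nickel_module[OF group_UT, of m ?as] malcev_coord_in_nickel_module[OF k(1)]
      unfolding f_def dual_submodule_def using step_mat_UT by blast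
    then have "card (f ` Pow F) \<le> nickel_dim ?G ?as" using ind(2) by (intro dim) auto
    moreover have "card (f ` Pow F) = 2 ^ (n div 2)"
      using ind(1) F by (simp add: card_image card_Pow)
    \<comment> \<open>The construction gives exponent \<open>n div 2 = (m - 1) div 2\<close>, at
      least the required one.\<close>
    moreover have "(2 :: nat) ^ (m div 2 - 1) \<le> 2 ^ (n div 2)"
      by (rule power_increasing) (use n in auto)
    ultimately show ?thesis by linarith
  qed
qed

end
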